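(* Let $(\mathcal{B}_t,\mathcal{L}_t,\mathbf{P})$ be a market for liquidity at time $t$ under the bilateral contracting mechanism. Given a net exposure matrix $\bar A_{t-1}$ at time $t-1$, let $\bar A^{*,\mathcal{T}}_t$, $\bar A^{*,\kappa}_t$ and $\bar A^*_t$ be the net exposure matrices formed at time $t$ with a systemic risk tax $\mathcal{T}$, with a Tobin-like tax $\kappa\ge0$ and without tax by the equilibrium (stable) matchings $\mu^{*,\mathcal{T}}_t$, $\mu^{*,\kappa}_t$ and $\mu^*_t$, respectively. Then: (i) for any $\mu^*_t\in\mathcal{EQ}_t$ such that $\mathrm{Vol}(\mu^*_t)=\nu$, there exists $\mathcal{T}$ such that $ESL(\bar A^{*,\mathcal{T}}_t,\vec E_t)\le ESL(\bar A^*_t,\vec E_t)$ and $\mathrm{Vol}(\mu^{*,\mathcal{T}}_t)\ge\mathrm{Vol}(\mu^*_t)$. In particular, there exists $\mathcal{T}$ such that $\mu^{*,\mathcal{T}}_t$ is systemic risk-efficient (for the volume $\nu$). (ii) for any $\mu^{*,\kappa}_t\in\mathcal{EQ}^{\kappa}_t$ such that $\mathrm{Vol}(\mu^{*,\kappa}_t)=\nu$, there exists $\mathcal{T}$ such that $ESL(\bar A^{*,\mathcal{T}}_t,\vec E_t)\le ESL(\bar A^{*,\kappa}_t,\vec E_t)$ and $\mathrm{Vol}(\mu^{*,\mathcal{T}}_t)\ge\mathrm{Vol}(\mu^{*,\kappa}_t)$.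
   Context: **Market.** $\mathcal{N}=\{1,\dots,n\}$ is a finite set of banks; $\mathcal{L}_t,\mathcal{B}_t\subseteq\mathcal{N}$ are disjoint sets (potential lenders and potential borrowers); $\mathbf{P}$ is the collection of all preference lists described below. Each lender $i$ has a base rate $r_i$, and the $r_i$ are strictly ordered (pairwise distinct). Each borrower $j$ has a reservation rate $\bar r_j$ and a default probability $\rho_j\in[0,1)$ on a loan of maturity $S\in\{1,2,\dots\}$ periods. All these quantities are given and commonly known. **Bilateral contracting mechanism.** The risk premium is $h_{ij}=\frac{1+r_i}{(1-\rho_j)^{1/S}}-1-r_i$, and without tax the rate paid by $j$ when borrowing from $i$ is $r_{ij}=r_i+h_{ij}$. Under a systemic risk tax $\mathcal{T}=(\tau_{ij})_{i\in\mathcal{L}_t,j\in\mathcal{B}_t}$, $\tau_{ij}\ge0$, the rate is $r^{\mathcal{T}}_{ij}=r_i+h_{ij}+\tau_{ij}$; under a Tobin-like tax $\kappa$ it is $r^\kappa_{ij}=r_i+h_{ij}+\kappa$. Reservation rates and lenders' preferences do not change under taxes. **Preferences.** Borrower $j$ prefers an option with a lower rate (rates of the relevant taxed or untaxed market), where the option "stay unmatched" (denoted $j$) has rate $\bar r_j$. Every lender is indifferent among all borrowers. **Matching.** A matching $\mu_t$ is a one-to-one correspondence from $\mathcal{N}$ onto itself with $\mu_t(\mu_t(a))=a$ for all $a$, such that for any $b\in\mathcal{B}_t$, if $\mu_t(b)\neq b$ then $\mu_t(b)\in\mathcal{L}_t$, and for any $l\in\mathcal{L}_t$, if $\mu_t(l)\neq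 l$ then $\mu_t(l)\in\mathcal{B}_t$. A bank $a$ with $\mu_t(a)=a$ is unmatched. The volume is $\mathrm{Vol}(\mu_t)=\frac12\sum_{i\in\mathcal{L}_t\cup\mathcal{B}_t}\mathbf{1}\{\mu_t(i)\neq i\}$. **Stable matching.** A matching $\mu^*$ is stable if: (I) (pairwise deviation) for all $i,l\in\mathcal{L}_t$ and $k,j\in\mathcal{B}_t$ such that $\mu^*(i)=j$ and $\mu^*(k)=l$, it cannot be that both $i$ strictly prefers $k$ to $j$ and $k$ strictly prefers $i$ to $l$; (II) (coalitional deviation) let $\vec b\subseteq\mathcal{B}_t$ be a set of borrowers such that their assigned lenders are indifferent between any borrowers in $\vec b$ (for any $j,k\in\vec b$, lender $\mu^*(j)$ is indifferent between $j$ and $k$); then there cannot be another matching $\mu'$ such that every $j\in\vec b$ strictly prefers $\mu'(j)$ to $\mu^*(j)$ (this condition expresses that no group of borrowing banks can agree to swap counter-parties if their lenders are indifferent); (III) (unilateral deviation) for any $j\in\mathcal{B}_t$ with $\mu^*(j)\neq j$, it cannot be that $j$ strictly prefers staying unmatched to $\mu^*(j)$; and for any $j\in\mathcal{B}_t$, it cannot be that $j$ strictly prefers to $\mu^*(j)$ some $k\in\mathcal{L}_t$ with $\mu^*(k)=k$. **Sets of matchings.** $\overline{\mathcal{EQ}}_t$ is the set of matchings with $r_{ij}<\bar r_j$ for all $\mu_t(i)=j$, $i\in\mathcal{L}_t$, $j\in\mathcal{B}_t$. $\mathcal{EQ}_t$ is the set of matchings such that $r_{ij}<\bar r_j$ for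 any $\mu_t(i)=j$ and $r_{ij}<r_{kj}$ for any such pair and any $k\in\mathcal{L}_t$ with $\mu_t(k)=k$. $\mathcal{EQ}^\kappa_t$ is the set of matchings such that $r^\kappa_{ij}<\bar r_j$ for any $\mu_t(i)=j$ and $r^\kappa_{ij}<r^\kappa_{kj}$ for any such pair and any $k\in\mathcal{L}_t$ with $\mu_t(k)=k$. **Net exposures.** $\bar A_{t-1}$ is an antisymmetric integer $n\times n$ matrix whose $(i,j)$ entry is the net amount lent by $i$ to $j$ at time $t-1$; $\bar A'_{t-1}$ is this matrix after removal of the loans maturing at $t$. Each new loan has size $1$. The net exposure matrix formed by a matching $\mu_t$ is $\bar A_t=\bar A'_{t-1}+\sum_{i\in\mathcal{L}_t,\,\mu_t(i)\ne i}\mathbf{1}_{\{i,\mu_t(i)\}}-\sum_{j\in\mathcal{B}_t,\,\mu_t(j)\ne j}\mathbf{1}_{\{j,\mu_t(j)\}}$, where $\mathbf{1}_{\{a,b\}}$ is the matrix with a single $1$ in position $(a,b)$ and zeros elsewhere. **Insolvency cascade and expected systemic loss.** $\vec E_t=(E^1_t,\dots,E^n_t)$ with $E_t^i>0$ are the banks' equities. Given an initially bankrupt bank $k$, set $E^k(0)=0$, $E^i(0)=E^i_t$ for $i\ne k$, $\sigma^i(0)=H$, $\theta^i(0)=0$ for all $i$, and for $\delta\ge1$ $$E^i(\delta)=\max\Big(0,\;E^i(\delta-1)-\sum_{j:\,\sigma^j(\delta-1)=F,\ \bar A^{ij}_t>0}\bar A^{ij}_t\Big),$$ $\sigma^i(\delta)=F$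 if $E^i(\delta)=0$ and $\sigma^i(\delta-1)=H$; $\sigma^i(\delta)=H$ if $E^i(\delta)>0$; $\sigma^i(\delta)=I$ if $\sigma^i(\delta-1)\in\{F,I\}$; and $\theta^i(\delta)=1$ if $\sigma^i(\delta)=F$ or $\theta^i(\delta-1)=1$, else $0$. The dynamics stop after finitely many steps $\bar\delta$. The systemic impact of $k$ is $SI^k(\bar A_t,\vec E_t)=\sum_{j\ne k}\mathbf{1}\{\theta^j(\bar\delta)=1\}E^j_t$ for the cascade started from $k$. With hazard rates $\gamma^j$ of exogenous default, $\gamma^{agg}=\sum_{j}\gamma^j$ and $\bar\rho^j_1=(1-e^{-\gamma^{agg}})\gamma^j/\gamma^{agg}$ (probability that $j$ is the first bank to go bankrupt exogenously over the next period), the expected systemic loss is $ESL(\bar A_t,\vec E_t)=\sum_{j=1}^n\bar\rho^j_1\,SI^j(\bar A_t,\vec E_t)$. **Systemic risk-efficiency.** For a trading volume $\nu$, an equilibrium matching is systemic risk-efficient if it belongs to the argmin of $ESL(\bar A_t,\vec E_t)$ over $\{\mu_t\in\overline{\mathcal{EQ}}_t:\mathrm{Vol}(\mu_t)=\nu\}$, where $\bar A_t$ is the net exposure matrix formed by $\mu_t$. *)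

theory Defs
  imports "HOL-Analysis.Cartesian_Space"
begin

text \<open>Banks are the elements of a finite type \<^typ>\<open>'b\<close>; banks that are neither potential lenders
  nor potential borrowers are allowed.\<close>

record 'b market =
  lenders :: "'b set"
  borrowers :: "'b set"
  base_rate :: "'b \<Rightarrow> real"
  reservation_rate :: "'b \<Rightarrow> real"
  default_prob :: "'b \<Rightarrow> real"
  maturity :: nat

definition liquidity_market :: "'b market \<Rightarrow> bool" where
  "liquidity_market M \<longleftrightarrow>
     lenders M \<inter> borrowers M = {} \<and>
     inj_on (base_rate M) (lenders M) \<and>
     (\<forall>j\<in>borrowers M. 0 \<le> default_prob M j \<and> default_prob M j < 1) \<and>
     1 \<le> maturity M"


subsection \<open>Rates and taxes\<close>

text \<open>In all rates and taxes the first index is the lender, the second one the borrower.\<close>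

definition risk_premium :: "'b market \<Rightarrow> 'b \<Rightarrow> 'b \<Rightarrow> real" where
  "risk_premium M i j =
     (1 + base_rate M i) / (1 - default_prob M j) powr (1 / real (maturity M)) - 1 - base_rate M i"

definition rate :: "'b market \<Rightarrow> 'b \<Rightarrow> 'b \<Rightarrow> real" where
  "rate M i j = base_rate M i + risk_premium M i j"

definition systemic_risk_tax :: "'b market \<Rightarrow> ('b \<Rightarrow> 'b \<Rightarrow> real) \<Rightarrow> bool" where
  "systemic_risk_tax M T \<longleftrightarrow> (\<forall>i\<in>lenders M. \<forall>j\<in>borrowers M. 0 \<le> T i j)"

definition taxed_rate :: "'b market \<Rightarrow> ('b \<Rightarrow> 'b \<Rightarrow> real) \<Rightarrow> 'b \<Rightarrow> 'b \<Rightarrow> real" where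
  "taxed_rate M T i j = base_rate M i + risk_premium M i j + T i j"

definition tobin_rate :: "'b market \<Rightarrow> real \<Rightarrow> 'b \<Rightarrow> 'b \<Rightarrow> real" where
  "tobin_rate M \<kappa> i j = base_rate M i + risk_premium M i j + \<kappa>"


subsection \<open>Preferences\<close>

text \<open>A preference profile \<open>P\<close> assigns to each bank a weak preference relation:
  \<open>P a x y\<close> means that bank \<open>a\<close> weakly prefers option \<open>x\<close> to option \<open>y\<close>, where the option \<open>a\<close>
  itself stands for staying unmatched.\<close>

type_synonym 'b profile = "'b \<Rightarrow> 'b \<Rightarrow> 'b \<Rightarrow> bool"

definition strictly_prefers :: "'b profile \<Rightarrow> 'b \<Rightarrow> 'b \<Rightarrow> 'b \<Rightarrow> bool" where
  "strictly_prefers P a x y \<longleftrightarrow> P a x y \<and> \<not> P a y x"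

definition indifferent :: "'b profile \<Rightarrow> 'b \<Rightarrow> 'b \<Rightarrow> 'b \<Rightarrow> bool" where
  "indifferent P a x y \<longleftrightarrow> P a x y \<and> P a y x"

definition option_rate :: "'b market \<Rightarrow> ('b \<Rightarrow> 'b \<Rightarrow> real) \<Rightarrow> 'b \<Rightarrow> 'b \<Rightarrow> real" where
  "option_rate M R j x = (if x = j then reservation_rate M j else R x j)"

text \<open>The profile of the bilateral contracting mechanism when the prevailing rates are \<open>R\<close>.
  Lenders compare borrowers only: stability never refers to how a lender ranks staying
  unmatched.\<close>

definition bilateral_profile :: "'b market \<Rightarrow> ('b \<Rightarrow> 'b \<Rightarrow> real) \<Rightarrow> 'b profile" where
  "bilateral_profile M R a x y \<longleftrightarrow>
     (a \<in> borrowers M \<and> option_rate M R a x \<le> option_rate M R a y) \<or>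
     (a \<in> lenders M \<and> x \<in> borrowers M \<and> y \<in> borrowers M)"


subsection \<open>Matchings and stability\<close>

definition matching :: "'b set \<Rightarrow> 'b set \<Rightarrow> ('b \<Rightarrow> 'b) \<Rightarrow> bool" where
  "matching L B \<mu> \<longleftrightarrow>
     bij \<mu> \<and> (\<forall>a. \<mu> (\<mu> a) = a) \<and>
     (\<forall>b\<in>B. \<mu> b \<noteq> b \<longrightarrow> \<mu> b \<in> L) \<and>
     (\<forall>l\<in>L. \<mu> l \<noteq> l \<longrightarrow> \<mu> l \<in> B)"

definition Vol :: "'b market \<Rightarrow> ('b \<Rightarrow> 'b) \<Rightarrow> real" where
  "Vol M \<mu> = 1 / 2 * (\<Sum>i\<in>lenders M \<union> borrowers M. of_bool (\<mu> i \<noteq> i))"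

definition no_pairwise_deviation :: "'b set \<Rightarrow> 'b set \<Rightarrow> 'b profile \<Rightarrow> ('b \<Rightarrow> 'b) \<Rightarrow> bool" where
  "no_pairwise_deviation L B P \<mu> \<longleftrightarrow>
     (\<forall>i\<in>L. \<forall>l\<in>L. \<forall>k\<in>B. \<forall>j\<in>B. \<mu> i = j \<and> \<mu> k = l \<longrightarrow>
        \<not> (strictly_prefers P i k j \<and> strictly_prefers P k i l))"

text \<open>A deviating coalition is nonempty and all its members have an assigned lender. The
  alternative matching is arbitrary.\<close>

definition no_coalitional_deviation :: "'b set \<Rightarrow> 'b set \<Rightarrow> 'b profile \<Rightarrow> ('b \<Rightarrow> 'b) \<Rightarrow> bool" where
  "no_coalitional_deviation L B P \<mu> \<longleftrightarrow>
     (\<forall>b. b \<subseteq> B \<and> b \<noteq> {} \<and> (\<forall>j\<in>b. \<mu> j \<in> L) \<and>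
          (\<forall>j\<in>b. \<forall>k\<in>b. indifferent P (\<mu> j) j k) \<longrightarrow>
        \<not> (\<exists>\<mu>'. matching L B \<mu>' \<and> (\<forall>j\<in>b. strictly_prefers P j (\<mu>' j) (\<mu> j))))"

definition no_unilateral_deviation :: "'b set \<Rightarrow> 'b set \<Rightarrow> 'b profile \<Rightarrow> ('b \<Rightarrow> 'b) \<Rightarrow> bool" where
  "no_unilateral_deviation L B P \<mu> \<longleftrightarrow>
     (\<forall>j\<in>B. \<mu> j \<noteq> j \<longrightarrow> \<not> strictly_prefers P j j (\<mu> j)) \<and>
     (\<forall>j\<in>B. \<not> (\<exists>k\<in>L. \<mu> k = k \<and> strictly_prefers P j k (\<mu> j)))"

definition stable_matching :: "'b set \<Rightarrow> 'b set \<Rightarrow> 'b profile \<Rightarrow> ('b \<Rightarrow> 'b) \<Rightarrow> bool" where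
  "stable_matching L B P \<mu> \<longleftrightarrow>
     matching L B \<mu> \<and>
     no_pairwise_deviation L B P \<mu> \<and>
     no_coalitional_deviation L B P \<mu> \<and>
     no_unilateral_deviation L B P \<mu>"

definition tax_equilibrium :: "'b market \<Rightarrow> ('b \<Rightarrow> 'b \<Rightarrow> real) \<Rightarrow> ('b \<Rightarrow> 'b) \<Rightarrow> bool" where
  "tax_equilibrium M T \<mu> \<longleftrightarrow>
     stable_matching (lenders M) (borrowers M) (bilateral_profile M (taxed_rate M T)) \<mu>"

definition EQ_bar :: "'b market \<Rightarrow> ('b \<Rightarrow> 'b) set" where
  "EQ_bar M = {\<mu>. matching (lenders M) (borrowers M) \<mu> \<and>
     (\<forall>i\<in>lenders M. \<forall>j\<in>borrowers M. \<mu> i = j \<longrightarrow> rate M i j < reservation_rate M j)}"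

definition EQ_for :: "'b market \<Rightarrow> ('b \<Rightarrow> 'b \<Rightarrow> real) \<Rightarrow> ('b \<Rightarrow> 'b) set" where
  "EQ_for M R = {\<mu>. matching (lenders M) (borrowers M) \<mu> \<and>
     (\<forall>i\<in>lenders M. \<forall>j\<in>borrowers M. \<mu> i = j \<longrightarrow>
        R i j < reservation_rate M j \<and>
        (\<forall>k\<in>lenders M. \<mu> k = k \<longrightarrow> R i j < R k j))}"

definition EQ :: "'b market \<Rightarrow> ('b \<Rightarrow> 'b) set" where
  "EQ M = EQ_for M (rate M)"

definition EQ_tobin :: "'b market \<Rightarrow> real \<Rightarrow> ('b \<Rightarrow> 'b) set" where
  "EQ_tobin M \<kappa> = EQ_for M (tobin_rate M \<kappa>)"


subsection \<open>Net exposures\<close>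

definition antisymmetric :: "int ^ 'b ^ 'b \<Rightarrow> bool" where
  "antisymmetric A \<longleftrightarrow> transpose A = - A"

text \<open>\<open>axis a (axis b 1)\<close> is the matrix with a single one, in row \<open>a\<close> and column \<open>b\<close>;
  \<open>A'\<close> is the previous net exposure matrix without the maturing loans.\<close>

definition net_exposure :: "'b::finite market \<Rightarrow> int ^ 'b ^ 'b \<Rightarrow> ('b \<Rightarrow> 'b) \<Rightarrow> int ^ 'b ^ 'b" where
  "net_exposure M A' \<mu> =
     A' + (\<Sum>i | i \<in> lenders M \<and> \<mu> i \<noteq> i. axis i (axis (\<mu> i) 1))
        - (\<Sum>j | j \<in> borrowers M \<and> \<mu> j \<noteq> j. axis j (axis (\<mu> j) 1))"


subsection \<open>Insolvency cascade and expected systemic loss\<close>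

datatype status = H | F | I

record 'b cascade_state =
  equity :: "'b \<Rightarrow> real"
  status :: "'b \<Rightarrow> status"
  failed :: "'b \<Rightarrow> bool"

text \<open>In \<open>cascade_step\<close> the component \<open>failed\<close> is the indicator usually called theta.
  The last case of the status update is the one where the previous status is \<open>F\<close> or \<open>I\<close>:
  along the cascade such a bank has equity zero.\<close>

definition cascade_step :: "int ^ 'b ^ 'b \<Rightarrow> 'b::finite cascade_state \<Rightarrow> 'b cascade_state" where
  "cascade_step A s =
     (let E' = (\<lambda>i. max 0 (equity s i -
                  (\<Sum>j | status s j = F \<and> A $ i $ j > 0. real_of_int (A $ i $ j))));
          \<sigma>' = (\<lambda>i. if E' i = 0 \<and> status s i = H then F
                     else if E' i > 0 then H
                     else I)
      in \<lparr>equity = E', status = \<sigma>', failed = (\<lambda>i. \<sigma>' i = F \<or> failed s i)\<rparr>)"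

primrec cascade ::
    "int ^ 'b ^ 'b \<Rightarrow> ('b::finite \<Rightarrow> real) \<Rightarrow> 'b \<Rightarrow> nat \<Rightarrow> 'b cascade_state" where
  "cascade A E k 0 = \<lparr>equity = E(k := 0), status = (\<lambda>_. H), failed = (\<lambda>_. False)\<rparr>"
| "cascade A E k (Suc \<delta>) = cascade_step A (cascade A E k \<delta>)"

definition stopping_step :: "int ^ 'b ^ 'b \<Rightarrow> ('b::finite \<Rightarrow> real) \<Rightarrow> 'b \<Rightarrow> nat" where
  "stopping_step A E k = (LEAST \<delta>. cascade A E k (Suc \<delta>) = cascade A E k \<delta>)"

definition SI :: "int ^ 'b ^ 'b \<Rightarrow> ('b::finite \<Rightarrow> real) \<Rightarrow> 'b \<Rightarrow> real" where
  "SI A E k = (\<Sum>j | j \<noteq> k. of_bool (failed (cascade A E k (stopping_step A E k)) j) * E j)"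

text \<open>If all hazard rates are zero, division by zero makes these probabilities zero, as they
  should be.\<close>

definition first_default_prob :: "('b::finite \<Rightarrow> real) \<Rightarrow> 'b \<Rightarrow> real" where
  "first_default_prob \<gamma> j =
     (let \<gamma>agg = (\<Sum>i\<in>UNIV. \<gamma> i) in (1 - exp (- \<gamma>agg)) * \<gamma> j / \<gamma>agg)"

definition ESL :: "('b::finite \<Rightarrow> real) \<Rightarrow> int ^ 'b ^ 'b \<Rightarrow> ('b \<Rightarrow> real) \<Rightarrow> real" where
  "ESL \<gamma> A E = (\<Sum>j\<in>UNIV. first_default_prob \<gamma> j * SI A E j)"

definition systemic_risk_efficient ::
    "'b::finite market \<Rightarrow> int ^ 'b ^ 'b \<Rightarrow> ('b \<Rightarrow> real) \<Rightarrow> ('b \<Rightarrow> real) \<Rightarrow> real \<Rightarrow> ('b \<Rightarrow> 'b) \<Rightarrow> bool"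
  where
  "systemic_risk_efficient M A' E \<gamma> \<nu> \<mu> \<longleftrightarrow>
     is_arg_min (\<lambda>\<mu>. ESL \<gamma> (net_exposure M A' \<mu>) E) (\<lambda>\<mu>. \<mu> \<in> EQ_bar M \<and> Vol M \<mu> = \<nu>) \<mu>"


subsection \<open>The cascade stops\<close>

lemma equity_step_nonneg: "0 \<le> equity (cascade_step A s) i"
  unfolding cascade_step_def Let_def cascade_state.select_convs by (rule max.cobounded1)

lemma status_step:
  "status (cascade_step A s) i =
     (if equity (cascade_step A s) i = 0 \<and> status s i = H then F
      else if equity (cascade_step A s) i > 0 then H else I)"
  unfolding cascade_step_def Let_def cascade_state.select_convs by (rule refl)

lemma failed_step:
  "failed (cascade_step A s) i \<longleftrightarrow> status (cascade_step A s) i = F \<or> failed s i"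
  unfolding cascade_step_def Let_def cascade_state.select_convs by (rule refl)

lemma equity_step:
  "equity (cascade_step A s) i =
     max 0 (equity s i - (\<Sum>j | status s j = F \<and> A $ i $ j > 0. real_of_int (A $ i $ j)))"
  unfolding cascade_step_def Let_def cascade_state.select_convs by (rule refl)

lemma cascade_invariant:
  assumes pos: "\<And>i. 0 < E i"
  shows "0 \<le> equity (cascade A E k \<delta>) i \<and>
         (status (cascade A E k \<delta>) i \<noteq> H \<longrightarrow> equity (cascade A E k \<delta>) i = 0)"
proof (cases \<delta>)
  case 0
  have "0 \<le> E i" by (rule less_imp_le) (rule pos)
  then show ?thesis by (simp add: 0)
next
  case (Suc d)
  show ?thesis
    unfolding Suc cascade.simps
    using equity_step_nonneg[of A "cascade A E k d" i] status_step[of A "cascade A E k d" i]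
    by (smt (verit))
qed

lemma cascade_stops:
  assumes pos: "\<And>i. 0 < E i"
  shows "\<exists>\<delta>. cascade A E k (Suc \<delta>) = cascade A E k \<delta>"
proof (rule ccontr)
  assume never: "\<not> ?thesis"
  define c where "c = cascade A E k"
  define w where "w x = (case x of H \<Rightarrow> 2 | F \<Rightarrow> 1 | I \<Rightarrow> (0::nat))" for x
  define W where "W \<delta> = (\<Sum>i\<in>UNIV. w (status (c \<delta>) i))" for \<delta>
  have step: "c (Suc \<delta>) = cascade_step A (c \<delta>)" for \<delta>
    by (simp add: c_def)
  have inv: "0 \<le> equity (c \<delta>) i" "status (c \<delta>) i \<noteq> H \<Longrightarrow> equity (c \<delta>) i = 0" for \<delta> i
    using cascade_invariant[where E=E and A=A and k=k and \<delta>=\<delta> and i=i, OF pos]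
    by (auto simp: c_def)
  have loss: "0 \<le> (\<Sum>j | status (c \<delta>) j = F \<and> A $ i $ j > 0. real_of_int (A $ i $ j))" for \<delta> i
    by (rule sum_nonneg) simp
  have eq0: "equity (c (Suc \<delta>)) i = 0" if "status (c \<delta>) i \<noteq> H" for \<delta> i
    using inv(2)[OF that] loss[where i = i and \<delta> = \<delta>]
    unfolding step equity_step by linarith
  have st_Suc: "status (c (Suc \<delta>)) i =
      (if equity (c (Suc \<delta>)) i = 0 \<and> status (c \<delta>) i = H then F
       else if equity (c (Suc \<delta>)) i > 0 then H else I)" for \<delta> i
    unfolding step by (rule status_step)
  have trans: "status (c (Suc \<delta>)) i \<in> (if status (c \<delta>) i = H then {H, F} else {I})" for \<delta> i
    using eq0[of \<delta> i] inv(1)[of "Suc \<delta>" i] by (simp add: st_Suc)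
  have le: "w (status (c (Suc \<delta>)) i) \<le> w (status (c \<delta>) i)" for \<delta> i
    using trans[of \<delta> i] by (cases "status (c \<delta>) i") (auto simp: w_def)
  have dec: "W (Suc \<delta>) < W \<delta>" for \<delta>
  proof -
    have "\<exists>i. w (status (c (Suc \<delta>)) i) < w (status (c \<delta>) i)"
    proof (rule ccontr)
      assume "\<not> ?thesis"
      then have weq: "w (status (c (Suc \<delta>)) i) = w (status (c \<delta>) i)" for i
        using le[of \<delta> i] by (meson le_neq_implies_less)
      have st: "status (c (Suc \<delta>)) i = status (c \<delta>) i \<and> status (c \<delta>) i \<noteq> F" for i
        using weq[of i] trans[of \<delta> i]
        by (cases "status (c \<delta>) i") (auto simp: w_def)
      have not_F: "{j. status (c \<delta>) j = F \<and> A $ i $ j > 0} = {}" for i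
        using st by blast
      have eq: "equity (c (Suc \<delta>)) i = equity (c \<delta>) i" for i
        using inv(1)[of \<delta> i] by (simp add: step equity_step not_F)
      have "failed (c (Suc \<delta>)) i = (status (c (Suc \<delta>)) i = F \<or> failed (c \<delta>) i)" for i
        unfolding step by (rule failed_step)
      then have fl: "failed (c (Suc \<delta>)) i = failed (c \<delta>) i" for i
        using st[of i] by metis
      have "c (Suc \<delta>) = c \<delta>"
        by (rule cascade_state.equality) (simp_all add: fun_eq_iff eq st fl)
      with never show False unfolding c_def by blast
    qed
    then show ?thesis
      unfolding W_def by (intro sum_strict_mono_ex1) (simp_all add: le)
  qed
  have "W \<delta> + \<delta> \<le> W 0" for \<delta>
  proof (induction \<delta>)
    case (Suc \<delta>)
    then show ?case using dec[of \<delta>] by linarith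
  qed simp
  from this[of "Suc (W 0)"] show False by simp
qed

end

theory Submission
  imports Defs
begin

text \<open>Any matching in \<open>EQ_bar\<close> is, up to the banks outside the market, the only equilibrium under
  a suitable tax: leave its pairs untaxed and lift every other rate strictly above the
  reservation rate of the borrower. Then each borrower's only acceptable lender is the
  prescribed one, no two borrowers compete for the same lender, and unilateral deviations force
  every stable matching to realise all prescribed pairs. Volume and systemic loss depend
  only on the banks in the market, so it remains to note that \<open>EQ_bar\<close> contains the untaxed and the
  Tobin-taxed equilibria, and that a minimiser of the loss exists because there are finitely many
  matchings.\<close>

text \<open>The \<open>1\<close> makes the lift above the reservation rate strict;
  \<open>max 0\<close> keeps the tax nonnegative where the untaxed rate is already high
  enough.\<close>

definition targeting_tax :: "'b market \<Rightarrow> ('b \<Rightarrow> 'b) \<Rightarrow> 'b \<Rightarrow> 'b \<Rightarrow> real" where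
  "targeting_tax M \<mu> i j =
     (if \<mu> i = j then 0 else max 0 (reservation_rate M j - rate M i j + 1))"

lemma systemic_risk_tax_targeting: "systemic_risk_tax M (targeting_tax M \<mu>)"
  by (simp add: systemic_risk_tax_def targeting_tax_def)

lemma taxed_rate_targeting:
  "\<mu> i = j \<Longrightarrow> taxed_rate M (targeting_tax M \<mu>) i j = rate M i j"
  "\<mu> i \<noteq> j \<Longrightarrow> reservation_rate M j < taxed_rate M (targeting_tax M \<mu>) i j"
  by (auto simp: taxed_rate_def targeting_tax_def rate_def)

lemma strictly_prefers_borrower:
  assumes "lenders M \<inter> borrowers M = {}" "j \<in> borrowers M"
  shows "strictly_prefers (bilateral_profile M R) j x y \<longleftrightarrow>
    option_rate M R j x < option_rate M R j y"
  using assms by (auto simp: strictly_prefers_def bilateral_profile_def)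

lemma not_strictly_prefers_lender:
  assumes "lenders M \<inter> borrowers M = {}" "i \<in> lenders M" "x \<in> borrowers M" "y \<in> borrowers M"
  shows "\<not> strictly_prefers (bilateral_profile M R) i x y"
  using assms by (auto simp: strictly_prefers_def bilateral_profile_def)

lemma EQ_barD:
  assumes "\<mu> \<in> EQ_bar M"
  shows "matching (lenders M) (borrowers M) \<mu>"
    and "\<And>a. \<mu> (\<mu> a) = a"
    and "\<And>j. j \<in> borrowers M \<Longrightarrow> \<mu> j \<noteq> j \<Longrightarrow>
      \<mu> j \<in> lenders M \<and> rate M (\<mu> j) j < reservation_rate M j"
    and "\<And>l. l \<in> lenders M \<Longrightarrow> \<mu> l \<noteq> l \<Longrightarrow> \<mu> l \<in> borrowers M"
proof -
  show m: "matching (lenders M) (borrowers M) \<mu>" and inv: "\<And>a. \<mu> (\<mu> a) = a"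
    and "\<And>l. l \<in> lenders M \<Longrightarrow> \<mu> l \<noteq> l \<Longrightarrow> \<mu> l \<in> borrowers M"
    using assms by (auto simp: EQ_bar_def matching_def)
  fix j assume j: "j \<in> borrowers M" "\<mu> j \<noteq> j"
  with m have "\<mu> j \<in> lenders M" by (auto simp: matching_def)
  \<comment> \<open>\<open>EQ_bar\<close> bounds rates of pairs indexed by their lender; the
    involution turns this into a bound for the borrower \<open>j\<close>.\<close>
  with j inv[of j] assms show "\<mu> j \<in> lenders M \<and> rate M (\<mu> j) j < reservation_rate M j"
    by (auto simp: EQ_bar_def)
qed

lemma tax_equilibrium_targeting:
  assumes disj: "lenders M \<inter> borrowers M = {}" and \<mu>: "\<mu> \<in> EQ_bar M"
  shows "tax_equilibrium M (targeting_tax M \<mu>) \<mu>"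
proof -
  define P where "P = bilateral_profile M (taxed_rate M (targeting_tax M \<mu>))"
  note m = EQ_barD(1)[OF \<mu>] and inv = EQ_barD(2)[OF \<mu>] and low = EQ_barD(3)[OF \<mu>]
  \<comment> \<open>Here \<open>x\<close> is any bank, so this one fact covers staying unmatched,
    free lenders and arbitrary alternative matchings. If \<open>\<mu> x = j\<close>, then
    \<open>x = \<mu> j\<close>; otherwise \<open>x\<close> costs the reservation rate
    (\<open>x = j\<close>) or more.\<close>
  have best: "\<not> strictly_prefers P j x (\<mu> j)" if j: "j \<in> borrowers M" for j x
  proof -
    have "option_rate M (taxed_rate M (targeting_tax M \<mu>)) j (\<mu> j)
        \<le> option_rate M (taxed_rate M (targeting_tax M \<mu>)) j x"
      using low[OF j] taxed_rate_targeting[of \<mu> x j M] taxed_rate_targeting(1)[of \<mu> "\<mu> j" j M]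
        inv[of x] inv[of j]
      by (cases "\<mu> x = j") (force simp: option_rate_def)+
    then show ?thesis
      by (simp add: P_def strictly_prefers_borrower[OF disj j])
  qed
  \<comment> \<open>A pairwise deviation would need a lender with a strict preference between
    borrowers.\<close>
  have "no_pairwise_deviation (lenders M) (borrowers M) P \<mu>"
    using not_strictly_prefers_lender[OF disj]
    by (auto simp: no_pairwise_deviation_def P_def)
  moreover have "no_coalitional_deviation (lenders M) (borrowers M) P \<mu>"
    using best by (fastforce simp: no_coalitional_deviation_def)
  moreover have "no_unilateral_deviation (lenders M) (borrowers M) P \<mu>"
    using best by (auto simp: no_unilateral_deviation_def)
  ultimately show ?thesis
    using m by (simp add: tax_equilibrium_def stable_matching_def P_def)
qed

text \<open>Unilateral deviations alone pin down the pairs. Agreement is confined to the market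
  because \<open>matching\<close> lets outside banks be permuted by any involution among
  themselves.\<close>

lemma tax_equilibrium_targeting_unique:
  assumes disj: "lenders M \<inter> borrowers M = {}" and \<mu>: "\<mu> \<in> EQ_bar M"
    and eq: "tax_equilibrium M (targeting_tax M \<mu>) \<mu>'"
    and a: "a \<in> lenders M \<union> borrowers M"
  shows "\<mu>' a = \<mu> a"
proof -
  define R where "R = taxed_rate M (targeting_tax M \<mu>)"
  note inv = EQ_barD(2)[OF \<mu>] and \<mu>B = EQ_barD(3)[OF \<mu>] and \<mu>L = EQ_barD(4)[OF \<mu>]
  have m': "matching (lenders M) (borrowers M) \<mu>'"
    and u: "no_unilateral_deviation (lenders M) (borrowers M) (bilateral_profile M R) \<mu>'"
    using eq by (auto simp: tax_equilibrium_def stable_matching_def R_def)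
  have inv': "\<And>a. \<mu>' (\<mu>' a) = a"
    and B': "\<And>j. j \<in> borrowers M \<Longrightarrow> \<mu>' j \<noteq> j \<Longrightarrow> \<mu>' j \<in> lenders M"
    and L': "\<And>l. l \<in> lenders M \<Longrightarrow> \<mu>' l \<noteq> l \<Longrightarrow> \<mu>' l \<in> borrowers M"
    using m' by (auto simp: matching_def)
  have acceptable: "option_rate M R j (\<mu>' j) \<le> reservation_rate M j"
    if "j \<in> borrowers M" "\<mu>' j \<noteq> j" for j
    using u that by (auto simp: no_unilateral_deviation_def strictly_prefers_borrower[OF disj]
        option_rate_def not_less)
  have free: "option_rate M R j (\<mu>' j) \<le> option_rate M R j k"
    if "j \<in> borrowers M" "k \<in> lenders M" "\<mu>' k = k" for j k
    using u that by (auto simp: no_unilateral_deviation_def strictly_prefers_borrower[OF disj]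
        not_less)
  \<comment> \<open>A matched borrower pays at most its reservation rate, and no lender other than
    the prescribed one charges so little.\<close>
  have matched: "\<mu>' j = \<mu> j" if j: "j \<in> borrowers M" "\<mu>' j \<noteq> j" for j
  proof -
    have "R (\<mu>' j) j \<le> reservation_rate M j"
      using acceptable[OF j] j by (simp add: option_rate_def)
    then have "\<mu> (\<mu>' j) = j"
      unfolding R_def using taxed_rate_targeting(2)[of \<mu> "\<mu>' j" j M] by fastforce
    then show ?thesis using inv by metis
  qed
  have B: "\<mu>' j = \<mu> j" if j: "j \<in> borrowers M" for j
  proof (rule ccontr)
    assume ne: "\<mu>' j \<noteq> \<mu> j"
    with matched[OF j] have j': "\<mu>' j = j" by auto
    with ne have nj: "\<mu> j \<noteq> j" by auto
    note low = \<mu>B[OF j nj]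
    \<comment> \<open>The prescribed lender of the unmatched \<open>j\<close> is either free, so
      that \<open>j\<close> would turn to it, or serves a borrower \<open>?k\<close>, whose own
      prescribed lender it then is by \<open>matched\<close>, forcing \<open>?k = j\<close>.\<close>
    show False
    proof (cases "\<mu>' (\<mu> j) = \<mu> j")
      case True
      have "option_rate M R j (\<mu>' j) \<le> option_rate M R j (\<mu> j)"
        using free[OF j _ True] low by blast
      then show False
        using low nj j' taxed_rate_targeting(1)[of \<mu> "\<mu> j" j M] inv[of j]
        by (simp add: option_rate_def R_def)
    next
      case False
      let ?k = "\<mu>' (\<mu> j)"
      have "?k \<in> borrowers M" "\<mu>' ?k \<noteq> ?k" using L' low False inv' by auto
      then have "\<mu>' ?k = \<mu> ?k" by (rule matched)
      then have "\<mu> ?k = \<mu> j" by (simp add: inv')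
      then have "?k = j" using inv by metis
      then show False using inv' j' nj by metis
    qed
  qed
  \<comment> \<open>A lender matched by either matching has a borrower as partner, and there
    \<open>B\<close> and the involutions settle the claim.\<close>
  have "\<mu>' l = \<mu> l" if l: "l \<in> lenders M" for l
  proof (cases "\<mu>' l = l")
    case True
    then show ?thesis using B \<mu>L[OF l] inv inv' by metis
  next
    case False
    then show ?thesis using B L'[OF l] inv inv' by metis
  qed
  with a B show ?thesis by blast
qed

lemma Vol_cong:
  assumes "\<And>a. a \<in> lenders M \<union> borrowers M \<Longrightarrow> \<mu>' a = \<mu> a"
  shows "Vol M \<mu>' = Vol M \<mu>"
  unfolding Vol_def using assms by simp

lemma net_exposure_cong:
  assumes "\<And>a. a \<in> lenders M \<union> borrowers M \<Longrightarrow> \<mu>' a = \<mu> a"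
  shows "net_exposure M A \<mu>' = net_exposure M A \<mu>"
proof -
  have "{i \<in> lenders M. \<mu>' i \<noteq> i} = {i \<in> lenders M. \<mu> i \<noteq> i}"
    "{i \<in> borrowers M. \<mu>' i \<noteq> i} = {i \<in> borrowers M. \<mu> i \<noteq> i}"
    using assms by auto
  then show ?thesis
    unfolding net_exposure_def using assms by (auto intro!: arg_cong2[where f = "(-)"] sum.cong)
qed

text \<open>That \<open>\<mu>'\<close> is a matching is assumed separately: bijectivity and
  involution also concern banks outside the market.\<close>

lemma EQ_bar_cong:
  assumes "\<And>a. a \<in> lenders M \<union> borrowers M \<Longrightarrow> \<mu>' a = \<mu> a"
    and "matching (lenders M) (borrowers M) \<mu>'" and "\<mu> \<in> EQ_bar M"
  shows "\<mu>' \<in> EQ_bar M"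
  using assms by (simp add: EQ_bar_def)

lemma EQ_subset_EQ_bar: "EQ M \<subseteq> EQ_bar M"
  by (auto simp: EQ_def EQ_for_def EQ_bar_def)

text \<open>A nonnegative \<kappa> only raises rates, so a pair acceptable with it is acceptable
  without it.\<close>

lemma EQ_tobin_subset_EQ_bar:
  assumes "0 \<le> \<kappa>"
  shows "EQ_tobin M \<kappa> \<subseteq> EQ_bar M"
  using assms by (force simp: EQ_tobin_def EQ_for_def EQ_bar_def tobin_rate_def rate_def)

text \<open>Existence of an equilibrium is included so that the claim about all equilibria is not
  vacuous.\<close>

lemma implementing_tax_exists:
  fixes M :: "'b::finite market"
  assumes "liquidity_market M" "\<mu> \<in> EQ_bar M"
  shows "\<exists>T. systemic_risk_tax M T \<and> (\<exists>\<mu>T. tax_equilibrium M T \<mu>T) \<and>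
    (\<forall>\<mu>T. tax_equilibrium M T \<mu>T \<longrightarrow> \<mu>T \<in> EQ_bar M \<and> Vol M \<mu>T = Vol M \<mu> \<and>
       (\<forall>A. net_exposure M A \<mu>T = net_exposure M A \<mu>))"
proof -
  have disj: "lenders M \<inter> borrowers M = {}"
    using assms by (simp add: liquidity_market_def)
  have "\<mu>T \<in> EQ_bar M \<and> Vol M \<mu>T = Vol M \<mu> \<and> (\<forall>A. net_exposure M A \<mu>T = net_exposure M A \<mu>)"
    if eq: "tax_equilibrium M (targeting_tax M \<mu>) \<mu>T" for \<mu>T
  proof -
    note agree = tax_equilibrium_targeting_unique[OF disj assms(2) eq]
    have "matching (lenders M) (borrowers M) \<mu>T"
      using eq by (simp add: tax_equilibrium_def stable_matching_def)
    then show ?thesis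
      using EQ_bar_cong[of M \<mu>T \<mu>, OF agree _ assms(2)] Vol_cong[of M \<mu>T \<mu>, OF agree]
        net_exposure_cong[of M \<mu>T \<mu>, OF agree]
      by blast
  qed
  then show ?thesis
    using systemic_risk_tax_targeting tax_equilibrium_targeting[OF disj assms(2)] by blast
qed

lemma systemic_risk_efficient_exists:
  fixes M :: "'b::finite market"
  assumes "\<mu> \<in> EQ_bar M" "Vol M \<mu> = \<nu>"
  shows "\<exists>\<mu>'. systemic_risk_efficient M A E \<gamma> \<nu> \<mu>'"
proof -
  let ?S = "{\<mu>. \<mu> \<in> EQ_bar M \<and> Vol M \<mu> = \<nu>}"
  \<comment> \<open>There are finitely many functions on a finite type, and \<mu> witnesses that the
    volume \<nu> is attained.\<close>
  have "finite ?S" "?S \<noteq> {}" using assms by auto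
  from ex_is_arg_min_if_finite[OF this, of "\<lambda>\<mu>. ESL \<gamma> (net_exposure M A \<mu>) E"]
  show ?thesis by (auto simp: systemic_risk_efficient_def)
qed

theorem proposition3:
  fixes M :: "'b::finite market"
    and A_prev A_maturing :: "int ^ 'b ^ 'b"
    and E \<gamma> :: "'b \<Rightarrow> real"
  assumes "liquidity_market M"
    and "antisymmetric A_prev"
    and "antisymmetric A_maturing"
    and "\<forall>i. 0 < E i"
    and "\<forall>j. 0 \<le> \<gamma> j"
  shows
    "(\<forall>\<mu> \<nu>. \<mu> \<in> EQ M \<and> Vol M \<mu> = \<nu> \<longrightarrow>
        (\<exists>T. systemic_risk_tax M T \<and>
           (\<exists>\<mu>T. tax_equilibrium M T \<mu>T) \<and>
           (\<forall>\<mu>T. tax_equilibrium M T \<mu>T \<longrightarrow>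
              ESL \<gamma> (net_exposure M (A_prev - A_maturing) \<mu>T) E
                \<le> ESL \<gamma> (net_exposure M (A_prev - A_maturing) \<mu>) E \<and>
              Vol M \<mu>T \<ge> Vol M \<mu>)) \<and>
        (\<exists>T. systemic_risk_tax M T \<and>
           (\<exists>\<mu>T. tax_equilibrium M T \<mu>T) \<and>
           (\<forall>\<mu>T. tax_equilibrium M T \<mu>T \<longrightarrow>
              systemic_risk_efficient M (A_prev - A_maturing) E \<gamma> \<nu> \<mu>T)))
     \<and>
     (\<forall>\<kappa> \<mu> \<nu>. 0 \<le> \<kappa> \<and> \<mu> \<in> EQ_tobin M \<kappa> \<and> Vol M \<mu> = \<nu> \<longrightarrow>
        (\<exists>T. systemic_risk_tax M T \<and>
           (\<exists>\<mu>T. tax_equilibrium M T \<mu>T) \<and>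
           (\<forall>\<mu>T. tax_equilibrium M T \<mu>T \<longrightarrow>
              ESL \<gamma> (net_exposure M (A_prev - A_maturing) \<mu>T) E
                \<le> ESL \<gamma> (net_exposure M (A_prev - A_maturing) \<mu>) E \<and>
              Vol M \<mu>T \<ge> Vol M \<mu>)))"
proof -
  let ?A = "A_prev - A_maturing"
  have implement: "\<exists>T. systemic_risk_tax M T \<and> (\<exists>\<mu>T. tax_equilibrium M T \<mu>T) \<and>
      (\<forall>\<mu>T. tax_equilibrium M T \<mu>T \<longrightarrow>
         ESL \<gamma> (net_exposure M ?A \<mu>T) E \<le> ESL \<gamma> (net_exposure M ?A \<mu>) E \<and> Vol M \<mu>T \<ge> Vol M \<mu>)"
    if "\<mu> \<in> EQ_bar M" for \<mu>
    \<comment> \<open>Targeting \<mu> itself gives both inequalities as equalities.\<close>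
    using implementing_tax_exists[OF assms(1) that] by (metis order_refl)
  have efficient: "\<exists>T. systemic_risk_tax M T \<and> (\<exists>\<mu>T. tax_equilibrium M T \<mu>T) \<and>
      (\<forall>\<mu>T. tax_equilibrium M T \<mu>T \<longrightarrow> systemic_risk_efficient M ?A E \<gamma> \<nu> \<mu>T)"
    if \<mu>: "\<mu> \<in> EQ_bar M" "Vol M \<mu> = \<nu>" for \<mu> \<nu>
  proof -
    \<comment> \<open>The tax now targets a minimiser instead of \<mu>. It is only known to lie in
      \<open>EQ_bar\<close>, which is why implementation is proved for that larger set.\<close>
    obtain \<mu>' where opt: "systemic_risk_efficient M ?A E \<gamma> \<nu> \<mu>'"
      using systemic_risk_efficient_exists[OF \<mu>] by blast
    then have "\<mu>' \<in> EQ_bar M"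
      by (simp add: systemic_risk_efficient_def is_arg_min_def)
    from implementing_tax_exists[OF assms(1) this] obtain T where T:
      "systemic_risk_tax M T" "\<exists>\<mu>T. tax_equilibrium M T \<mu>T"
      "\<And>\<mu>T. tax_equilibrium M T \<mu>T \<Longrightarrow> \<mu>T \<in> EQ_bar M \<and> Vol M \<mu>T = Vol M \<mu>' \<and>
         (\<forall>A. net_exposure M A \<mu>T = net_exposure M A \<mu>')"
      by blast
    \<comment> \<open>Every equilibrium \<open>\<mu>T\<close> shares the volume and net exposures of
      the minimiser, hence its loss, and lies in \<open>EQ_bar\<close>.\<close>
    have "systemic_risk_efficient M ?A E \<gamma> \<nu> \<mu>T" if "tax_equilibrium M T \<mu>T" for \<mu>T
      using opt T(3)[OF that] by (simp add: systemic_risk_efficient_def is_arg_min_def)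
    with T(1,2) show ?thesis by blast
  qed
  show ?thesis
    using implement efficient EQ_subset_EQ_bar EQ_tobin_subset_EQ_bar
    by (intro conjI allI impI) blast+
qed

end
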